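(* Let $0<\alpha<1$ be a real constant. Assume that for each natural number $n$ a set $F_n\subseteq\{0,1\}^n$ of forbidden strings of length $n$ is fixed, with $\#F_n\le 2^{\alpha n}$. Then there exist an infinite almost periodic binary sequence $\omega$ and a constant $N$ such that for any $n>N$ the sequence $\omega$ does not have a substring $x$ that belongs to $F_n$.
   Context: A substring of an infinite sequence $\omega=\omega_0\omega_1\omega_2\ldots$ is a finite string of consecutive terms of $\omega$. A sequence $\omega$ is called almost periodic if each of its substrings has infinitely many occurrences at limited distances, i.e. for any substring $x$ of $\omega$ there exists a number $k$ such that any substring $y$ of $\omega$ of length $k$ contains $x$ as a substring. *)

theory Defs
  imports Complex_Main "HOL-Library.Sublist"
begin

(* The binary alphabet {0,1} is bool, so {0,1}^n is the set of bool lists of length n.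
   The library's sublist is the contiguous notion (not scattered subsequences). *)

definition substring_of :: "'a list \<Rightarrow> (nat \<Rightarrow> 'a) \<Rightarrow> bool" where
  "substring_of x \<omega> \<longleftrightarrow> (\<exists>i j. x = map \<omega> [i..<j])"

definition almost_periodic :: "(nat \<Rightarrow> 'a) \<Rightarrow> bool" where
  "almost_periodic \<omega> \<longleftrightarrow>
     (\<forall>x. substring_of x \<omega> \<longrightarrow>
        (\<exists>k. \<forall>y. substring_of y \<omega> \<and> length y = k \<longrightarrow> sublist x y))"

end

theory Submission
  imports Defs
begin

text \<open>
  Call a set of words avoidable if arbitrarily long words contain no member of it. If the
  forbidden words are exponentially rarer than all words, then the number of words of length
  \<open>n\<close> avoiding them grows exponentially, because appending a letter to an avoiding word
  creates only forbidden suffixes; so the set of long forbidden words is avoidable. By Zorn's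
  lemma it lies in a maximal avoidable set \<open>M\<close>, and by compactness some infinite sequence
  avoids \<open>M\<close>. If \<open>x\<close> is a substring of it, then \<open>M \<union> {x}\<close> is not avoidable
  by maximality, so for some \<open>k\<close> every word of length \<open>k\<close> that avoids \<open>M\<close>,
  in particular every substring of length \<open>k\<close> of the sequence, contains \<open>x\<close>.
\<close>

definition avoids :: "'a list set \<Rightarrow> 'a list \<Rightarrow> bool" where
  "avoids S w \<longleftrightarrow> (\<forall>x\<in>S. \<not> sublist x w)"

text \<open>Words of different lengths need not extend one another here. This finitary form is what
  lets avoidability pass to unions of chains.\<close>

definition avoidable :: "'a list set \<Rightarrow> bool" where
  "avoidable S \<longleftrightarrow> (\<forall>n. \<exists>w. length w = n \<and> avoids S w)"

definition avoiding_words :: "'a list set \<Rightarrow> nat \<Rightarrow> 'a list set" where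
  "avoiding_words S n = {w. length w = n \<and> avoids S w}"

lemma avoids_sublist: "avoids S w \<Longrightarrow> sublist v w \<Longrightarrow> avoids S v"
  unfolding avoids_def using sublist_order.order_trans by blast

lemma finite_length_eq: "finite {w :: 'a::finite list. length w = n}"
  using finite_lists_length_eq[of "UNIV :: 'a set" n] by simp

lemma finite_length_le: "finite {w :: 'a::finite list. length w \<le> n}"
  using finite_lists_length_le[of "UNIV :: 'a set" n] by simp

lemma finite_avoiding_words: "finite (avoiding_words S n :: 'a::finite list set)"
  unfolding avoiding_words_def by (rule finite_subset[OF _ finite_length_eq[of n]]) auto


subsection \<open>Growth of the number of avoiding words\<close>

text \<open>As \<open>w\<close> avoids \<open>S\<close>, a forbidden word in \<open>w @ [a]\<close>
  must end at the new letter, so it is a nonempty suffix \<open>x\<close>. Cutting it off leaves a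
  prefix of \<open>w\<close>, which still avoids \<open>S\<close>. The index \<open>j\<close> is the
  length of the part of \<open>x\<close> inside \<open>w\<close>.\<close>

lemma snoc_avoiding_words_subset:
  assumes "[] \<notin> S"
  shows "(\<lambda>(w, a). w @ [a]) ` (avoiding_words S n \<times> UNIV) \<subseteq>
    avoiding_words S (Suc n) \<union>
    (\<Union>j\<le>n. (\<lambda>(u, x). u @ x) ` (avoiding_words S (n - j) \<times> {x\<in>S. length x = Suc j}))"
    (is "?E \<subseteq> ?A \<union> ?B")
proof
  fix v assume "v \<in> ?E"
  then obtain w a where v: "v = w @ [a]" and w: "length w = n" "avoids S w"
    by (auto simp: avoiding_words_def)
  show "v \<in> ?A \<union> ?B"
  proof (cases "avoids S v")
    case True
    then show ?thesis using v w by (simp add: avoiding_words_def)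
  next
    case False
    then obtain x where x: "x \<in> S" "sublist x v" by (auto simp: avoids_def)
    then have "suffix x (w @ [a])"
      using w v by (auto simp: sublist_snoc avoids_def)
    moreover have "x \<noteq> []" using x assms by auto
    ultimately obtain x' where "x = x' @ [a]" "suffix x' w"
      by auto
    then obtain u where x': "x = x' @ [a]" "w = u @ x'"
      by (auto simp: suffix_def)
    then have "avoids S u" using avoids_sublist[OF w(2)] by simp
    then have "(u, x) \<in> avoiding_words S (n - length x') \<times> {x\<in>S. length x = Suc (length x')}"
      using x x' w by (auto simp: avoiding_words_def)
    moreover have "v = u @ x" "length x' \<le> n" using v x' w by auto
    ultimately show ?thesis by force
  qed
qed

lemma card_avoiding_words_Suc_ge:
  fixes S :: "'a::finite list set"
  assumes "[] \<notin> S"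
  shows "card (UNIV :: 'a set) * card (avoiding_words S n) \<le> card (avoiding_words S (Suc n)) +
    (\<Sum>j\<le>n. card (avoiding_words S (n - j)) * card {x\<in>S. length x = Suc j})"
proof -
  let ?B = "\<lambda>j. (\<lambda>(u, x). u @ x) ` (avoiding_words S (n - j) \<times> {x\<in>S. length x = Suc j})"
  have finS: "finite {x\<in>S. length x = m}" for m
    by (rule finite_subset[OF _ finite_length_eq[of m]]) auto
  have finB: "finite (?B j)" for j
    by (intro finite_imageI finite_cartesian_product finite_avoiding_words finS)
  have cardB: "card (?B j) \<le> card (avoiding_words S (n - j)) * card {x\<in>S. length x = Suc j}" for j
    using card_image_le[of "avoiding_words S (n - j) \<times> {x\<in>S. length x = Suc j}" "\<lambda>(u, x). u @ x"]
    by (simp add: card_cartesian_product finite_avoiding_words finS)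
  have "card (UNIV :: 'a set) * card (avoiding_words S n) =
      card ((\<lambda>(w, a). w @ [a]) ` (avoiding_words S n \<times> UNIV))"
    by (subst card_image) (auto simp: inj_on_def card_cartesian_product)
  also have "\<dots> \<le> card (avoiding_words S (Suc n) \<union> (\<Union>j\<le>n. ?B j))"
    by (rule card_mono[OF _ snoc_avoiding_words_subset[OF assms]])
       (use finB finite_avoiding_words in auto)
  also have "\<dots> \<le> card (avoiding_words S (Suc n)) + card (\<Union>j\<le>n. ?B j)"
    by (rule card_Un_le)
  also have "card (\<Union>j\<le>n. ?B j) \<le> (\<Sum>j\<le>n. card (?B j))"
    by (rule card_UN_le) simp
  also have "\<dots> \<le> (\<Sum>j\<le>n. card (avoiding_words S (n - j)) * card {x\<in>S. length x = Suc j})"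
    by (intro sum_mono cardB)
  finally show ?thesis by simp
qed

text \<open>Of the one-letter extensions, the assumed sum lets at most a proportion be lost that
  still leaves \<open>\<beta>\<close> good ones per word on average. Strong induction is needed
  because the loss involves all shorter lengths.\<close>

lemma card_avoiding_words_growth:
  fixes S :: "'a::finite list set" and \<beta> :: real
  assumes "[] \<notin> S" and "\<beta> > 0"
    and sum: "\<And>n. (\<Sum>j\<le>n. real (card {x\<in>S. length x = Suc j}) / \<beta> ^ j)
      \<le> real (card (UNIV :: 'a set)) - \<beta>"
  shows "\<beta> * real (card (avoiding_words S n)) \<le> real (card (avoiding_words S (Suc n)))"
proof (induction n rule: less_induct)
  case (less n)
  define a where "a m = real (card (avoiding_words S m))" for m
  define b where "b j = real (card {x\<in>S. length x = Suc j})" for j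
  \<comment> \<open>Iterating the induction hypothesis downwards from \<open>n\<close> bounds the
    shorter counts by the count at \<open>n\<close>.\<close>
  have shift: "\<beta> ^ j * a (n - j) \<le> a n" if "j \<le> n" for j
    using that
  proof (induction j)
    case (Suc j)
    have "\<beta> * a (n - Suc j) \<le> a (n - j)"
      using less.IH[of "n - Suc j"] Suc.prems by (simp add: a_def Suc_diff_Suc)
    then have "\<beta> ^ Suc j * a (n - Suc j) \<le> \<beta> ^ j * a (n - j)"
      using \<open>\<beta> > 0\<close> by (simp add: mult.commute mult.left_commute)
    then show ?case using Suc by simp
  qed simp
  have "real (card (UNIV :: 'a set)) * a n \<le> a (Suc n) + (\<Sum>j\<le>n. a (n - j) * b j)"
    using of_nat_mono[OF card_avoiding_words_Suc_ge[OF assms(1), of n], where 'a=real]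
    by (simp add: a_def b_def)
  also have "(\<Sum>j\<le>n. a (n - j) * b j) \<le> (\<Sum>j\<le>n. a n * (b j / \<beta> ^ j))"
  proof (rule sum_mono)
    fix j assume "j \<in> {..n}"
    then have "a (n - j) \<le> a n / \<beta> ^ j"
      using shift[of j] \<open>\<beta> > 0\<close> by (simp add: field_simps)
    then have "a (n - j) * b j \<le> a n / \<beta> ^ j * b j"
      by (rule mult_right_mono) (simp add: b_def)
    then show "a (n - j) * b j \<le> a n * (b j / \<beta> ^ j)" by simp
  qed
  also have "\<dots> = a n * (\<Sum>j\<le>n. b j / \<beta> ^ j)" by (simp add: sum_distrib_left)
  also have "\<dots> \<le> a n * (real (card (UNIV :: 'a set)) - \<beta>)"
    using sum by (intro mult_left_mono) (auto simp: a_def b_def)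
  finally show ?case by (simp add: a_def algebra_simps)
qed

lemma avoidable_if_sum_le:
  fixes S :: "'a::finite list set" and \<beta> :: real
  assumes "[] \<notin> S" and "\<beta> > 0"
    and "\<And>n. (\<Sum>j\<le>n. real (card {x\<in>S. length x = Suc j}) / \<beta> ^ j)
      \<le> real (card (UNIV :: 'a set)) - \<beta>"
  shows "avoidable S"
proof -
  have "card (avoiding_words S n) > 0" for n
  proof (induction n)
    case 0
    have "avoiding_words S 0 = {[]}"
      using assms(1) by (auto simp: avoiding_words_def avoids_def)
    then show ?case by simp
  next
    case (Suc n)
    then have "0 < \<beta> * real (card (avoiding_words S n))" using assms(2) by simp
    then show ?case
      using card_avoiding_words_growth[OF assms, of n] by linarith
  qed
  then have "avoiding_words S n \<noteq> {}" for n by (metis card.empty less_irrefl)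
  then show ?thesis by (auto simp: avoidable_def avoiding_words_def)
qed


subsection \<open>Maximal avoidable sets and infinite sequences\<close>

text \<open>A word of length \<open>n\<close> can only contain words of length at most
  \<open>n\<close>. Over a finite alphabet these are finitely many, so those in the union already
  lie in one member of the chain.\<close>

lemma avoidable_Union_chain:
  fixes \<C> :: "'a::finite list set set"
  assumes "\<C> \<noteq> {}" and "subset.chain \<A> \<C>" and "\<And>S. S \<in> \<C> \<Longrightarrow> avoidable S"
  shows "avoidable (\<Union>\<C>)"
  unfolding avoidable_def
proof
  fix n
  have "finite (\<Union>\<C> \<inter> {x. length x \<le> n})" using finite_length_le by blast
  then obtain S where S: "S \<in> \<C>" "\<Union>\<C> \<inter> {x. length x \<le> n} \<subseteq> S"
    using finite_subset_Union_chain[OF _ _ assms(1,2)] by (metis inf_le1)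
  then obtain w where w: "length w = n" "avoids S w"
    using assms(3) unfolding avoidable_def by blast
  then have "avoids (\<Union>\<C>) w"
    using S(2) sublist_length_le unfolding avoids_def by blast
  then show "\<exists>w. length w = n \<and> avoids (\<Union>\<C>) w" using w by blast
qed

lemma maximal_avoidable:
  fixes S :: "'a::finite list set"
  assumes "avoidable S"
  shows "\<exists>M. S \<subseteq> M \<and> avoidable M \<and> (\<forall>x. x \<notin> M \<longrightarrow> \<not> avoidable (insert x M))"
proof -
  have "\<exists>M\<in>{T. S \<subseteq> T \<and> avoidable T}. \<forall>X\<in>{T. S \<subseteq> T \<and> avoidable T}. M \<subseteq> X \<longrightarrow> X = M"
  proof (rule subset_Zorn_nonempty)
    fix \<C> assume C: "\<C> \<noteq> {}" "subset.chain {T. S \<subseteq> T \<and> avoidable T} \<C>"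
    then have "\<C> \<subseteq> {T. S \<subseteq> T \<and> avoidable T}" by (simp add: subset.chain_def)
    then show "\<Union>\<C> \<in> {T. S \<subseteq> T \<and> avoidable T}"
      using avoidable_Union_chain[OF C] C(1) by blast
  qed (use assms in auto)
  then obtain M where M: "S \<subseteq> M" "avoidable M"
    and max: "\<forall>X\<in>{T. S \<subseteq> T \<and> avoidable T}. M \<subseteq> X \<longrightarrow> X = M"
    by blast
  have "\<not> avoidable (insert x M)" if "x \<notin> M" for x
    using bspec[OF max, of "insert x M"] M(1) that by blast
  with M show ?thesis by blast
qed

lemma avoidable_imp_sequence:
  fixes S :: "'a::finite list set"
  assumes "avoidable S"
  shows "\<exists>\<omega>. \<forall>x. substring_of x \<omega> \<longrightarrow> avoids S x"
proof -
  define ext where "ext w \<longleftrightarrow> (\<forall>n. \<exists>v. length v = n \<and> avoids S (w @ v))" for w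
  have step: "\<exists>a. ext (w @ [a])" if "ext w" for w
  proof (rule ccontr)
    assume "\<nexists>a. ext (w @ [a])"
    \<comment> \<open>Each letter \<open>a\<close> would be blocked at some length
      \<open>m a\<close>. The maximum over the finite alphabet blocks all letters at once; the
      \<open>Suc\<close> below makes room for the letter itself.\<close>
    then have "\<forall>a. \<exists>n. \<forall>v. length v = n \<longrightarrow> \<not> avoids S (w @ [a] @ v)"
      by (simp add: ext_def)
    then obtain m where m: "\<And>a v. length v = m a \<Longrightarrow> \<not> avoids S (w @ [a] @ v)"
      by metis
    obtain u where u: "length u = Suc (Max (range m))" "avoids S (w @ u)"
      using \<open>ext w\<close> by (auto simp: ext_def)
    then obtain a v where v: "u = a # v" "length v = Max (range m)"
      by (auto simp: length_Suc_conv)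
    then have "m a \<le> length v" by simp
    moreover have "sublist (w @ [a] @ take (m a) v) (w @ u)"
      using v(1) by (metis append.assoc append_Cons append_Nil append_take_drop_id sublist_append_rightI)
    ultimately show False
      using m[of "take (m a) v" a] avoids_sublist[OF u(2)] by simp
  qed
  have "\<exists>f. \<forall>n. (ext (f n) \<and> length (f n) = n) \<and> (\<exists>a. f (Suc n) = f n @ [a])"
  proof (rule dependent_nat_choice)
    show "\<exists>w. ext w \<and> length w = 0"
      using assms by (auto simp: ext_def avoidable_def)
  qed (use step in fastforce)
  then obtain f where f: "\<And>n. ext (f n)" "\<And>n. \<exists>a. f (Suc n) = f n @ [a]" "\<And>n. length (f n) = n"
    by blast
  \<comment> \<open>Each \<open>f n\<close> is a prefix of \<open>f (Suc n)\<close>, so the letter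
    added last is the term of index \<open>n\<close>.\<close>
  define \<omega> where "\<omega> n = last (f (Suc n))" for n
  have f_eq: "f n = map \<omega> [0..<n]" for n
  proof (induction n)
    case 0
    then show ?case using f(3)[of 0] by simp
  next
    case (Suc n)
    then show ?case using f(2)[of n] by (auto simp: \<omega>_def)
  qed
  have "avoids S (map \<omega> [i..<j])" for i j
  proof -
    \<comment> \<open>The prolongation of length 0 shows that \<open>f j\<close> itself avoids
      \<open>S\<close>.\<close>
    have "avoids S (f j)"
      using f(1)[of j] by (auto simp: ext_def dest: spec[of _ 0])
    moreover have "map \<omega> [i..<j] = drop i (f j)" by (simp add: f_eq drop_map)
    ultimately show ?thesis by (metis avoids_sublist sublist_drop)
  qed
  then show ?thesis by (auto simp: substring_of_def)
qed

lemma avoidable_imp_almost_periodic: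
  fixes S :: "'a::finite list set"
  assumes "avoidable S"
  shows "\<exists>\<omega>. almost_periodic \<omega> \<and> (\<forall>x. substring_of x \<omega> \<longrightarrow> x \<notin> S)"
proof -
  obtain M where M: "S \<subseteq> M" "avoidable M"
    and max: "\<And>x. x \<notin> M \<Longrightarrow> \<not> avoidable (insert x M)"
    using maximal_avoidable[OF assms] by blast
  obtain \<omega> where \<omega>: "\<And>x. substring_of x \<omega> \<Longrightarrow> avoids M x"
    using avoidable_imp_sequence[OF M(2)] by blast
  \<comment> \<open>Every word is a sublist of itself. This is needed since maximality speaks only
    of words outside \<open>M\<close>.\<close>
  have notin: "x \<notin> M" if "substring_of x \<omega>" for x
    using \<omega>[OF that] by (auto simp: avoids_def)
  have "almost_periodic \<omega>"
    unfolding almost_periodic_def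
  proof (intro allI impI)
    fix x assume "substring_of x \<omega>"
    then obtain k where "\<And>w. length w = k \<Longrightarrow> \<not> avoids (insert x M) w"
      using max notin unfolding avoidable_def by blast
    then show "\<exists>k. \<forall>y. substring_of y \<omega> \<and> length y = k \<longrightarrow> sublist x y"
      using \<omega> unfolding avoids_def by blast
  qed
  with notin M(1) show ?thesis by blast
qed

section \<open>Counting the long forbidden binary words\<close>

lemma long_words_avoidable:
  fixes \<alpha> :: real and F :: "nat \<Rightarrow> bool list set"
  assumes "\<alpha> < 1"
    and len: "\<And>n. F n \<subseteq> {x. length x = n}"
    and card: "\<And>n. real (card (F n)) \<le> 2 powr (\<alpha> * real n)"
  shows "\<exists>N. avoidable (\<Union>n\<in>{N<..}. F n)"
proof -
  have "2 powr \<alpha> < (2::real)" using powr_less_mono[of \<alpha> 1 "2::real"] assms(1) by simp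
  \<comment> \<open>The lower bound on \<open>\<beta>\<close> makes the ratio \<open>q\<close>
    smaller than 1; the upper bound leaves the positive margin \<open>2 - \<beta>\<close> for the
    sum.\<close>
  then obtain \<beta> :: real where \<beta>: "2 powr \<alpha> < \<beta>" "\<beta> < 2" using dense by blast
  have "\<beta> > 0" by (rule less_trans[OF _ \<beta>(1)]) simp
  define q where "q = 2 powr \<alpha> / \<beta>"
  have "summable (\<lambda>j. 2 powr \<alpha> * q ^ j)"
    using \<beta> \<open>\<beta> > 0\<close> by (intro summable_mult summable_geometric) (simp add: q_def)
  \<comment> \<open>The Cauchy criterion makes every block of the geometric series from
    \<open>N\<close> on smaller than the margin; this \<open>N\<close> becomes the length
    threshold.\<close>
  then obtain N where N: "\<And>m n. m \<ge> N \<Longrightarrow> norm (\<Sum>j=m..<n. 2 powr \<alpha> * q ^ j) < 2 - \<beta>"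
    using \<beta>(2) unfolding summable_Cauchy by (meson diff_gt_0_iff_gt)
  let ?S = "\<Union>n\<in>{N<..}. F n"
  \<comment> \<open>Length \<open>Suc j\<close> exceeds \<open>N\<close> exactly when
    \<open>N \<le> j\<close>. The factor \<open>2 powr \<alpha>\<close> comes from pairing words of
    length \<open>Suc j\<close> with the power \<open>\<beta> ^ j\<close>.\<close>
  have term_le: "real (card {x\<in>?S. length x = Suc j}) / \<beta> ^ j \<le>
      (if N \<le> j then 2 powr \<alpha> * q ^ j else 0)" for j
  proof (cases "N \<le> j")
    case True
    then have "{x\<in>?S. length x = Suc j} = F (Suc j)" using len by fastforce
    then have "real (card {x\<in>?S. length x = Suc j}) \<le> 2 powr (\<alpha> * real (Suc j))"
      using card by metis
    also have "\<dots> = 2 powr \<alpha> * (2 powr \<alpha>) ^ j"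
      by (simp add: powr_powr powr_add distrib_left flip: powr_realpow)
    finally show ?thesis
      using True \<open>\<beta> > 0\<close> by (simp add: q_def power_divide divide_right_mono)
  next
    case False
    then have empty: "{x\<in>?S. length x = Suc j} = {}" using len by fastforce
    show ?thesis unfolding empty using False by simp
  qed
  have "(\<Sum>j\<le>n. real (card {x\<in>?S. length x = Suc j}) / \<beta> ^ j) \<le> 2 - \<beta>" for n
  proof -
    have "(\<Sum>j\<le>n. real (card {x\<in>?S. length x = Suc j}) / \<beta> ^ j) \<le>
        (\<Sum>j\<le>n. if N \<le> j then 2 powr \<alpha> * q ^ j else 0)"
      by (intro sum_mono term_le)
    also have "\<dots> = (\<Sum>j=N..<Suc n. 2 powr \<alpha> * q ^ j)"
      by (rule sum.mono_neutral_cong_right) auto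
    also have "\<dots> \<le> 2 - \<beta>" using N[of N "Suc n"] by simp
    finally show ?thesis .
  qed
  \<comment> \<open>All indices in the union exceed \<open>N\<close>, so they are positive.\<close>
  moreover have "[] \<notin> ?S" using len by fastforce
  ultimately have "avoidable ?S"
    using avoidable_if_sum_le[of ?S \<beta>] \<open>\<beta> > 0\<close> by simp
  then show ?thesis ..
qed

theorem mainTheorem4:
  fixes \<alpha> :: real and F :: "nat \<Rightarrow> bool list set"
  assumes "0 < \<alpha>" and "\<alpha> < 1"
    and "\<And>n. F n \<subseteq> {x. length x = n}"
    and "\<And>n. real (card (F n)) \<le> 2 powr (\<alpha> * real n)"
  shows "\<exists>(\<omega> :: nat \<Rightarrow> bool) (N :: nat). almost_periodic \<omega> \<and>
           (\<forall>n>N. \<not> (\<exists>x. substring_of x \<omega> \<and> x \<in> F n))"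
proof -
  obtain N where "avoidable (\<Union>n\<in>{N<..}. F n)"
    using long_words_avoidable[OF assms(2-4)] by blast
  then show ?thesis using avoidable_imp_almost_periodic by fastforce
qed

end
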